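(* Let $X_1,X_2,\ldots$ be i.i.d. non-negative random variables with $\mathbb{E}[X_1]=\mu>0$ and $\mathbb{E}[X_1^2]=\mu_2<\infty$. Let $p\in(0,1)$, let $N\sim\mathrm{Geo}^0(p)$ be independent of the $X_i$, set \[ W=\frac{p}{\mu(1-p)}\sum_{i=1}^N X_i , \] and let $Z\sim\mathrm{Exp}(1)$. Then \[ d_{\mathrm W}(\mathcal L(W),\mathcal L(Z))\le\frac{p\,\mu_2}{(1-p)\mu^2}. \] Moreover, the $O(p)$ rate as $p\to0$ in this bound is optimal: for each fixed law of $X_1$ on $[0,\infty)$ with $\mathbb{E}[X_1]>0$ and $\mathbb{E}[X_1^2]<\infty$ there exist $c>0$ and $p_0\in(0,1)$, depending only on the law of $X_1$, such that $d_{\mathrm W}(\mathcal L(W),\mathcal L(Z))\ge c\,p$ for all $p\in(0,p_0)$.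
   Context: $\mathrm{Geo}^0(p)$ is the distribution on $\{0,1,2,\ldots\}$ with $\mathbb{P}(N=k)=p(1-p)^k$; an empty sum is $0$. For non-negative random variables $U,V$, the Wasserstein distance is $d_{\mathrm W}(\mathcal L(U),\mathcal L(V))=\sup_{h\in\mathrm{Lip}(1)}|\mathbb{E}[h(U)]-\mathbb{E}[h(V)]|$, where $\mathrm{Lip}(1)=\{h:[0,\infty)\to\mathbb{R} : |h(x)-h(y)|\le|x-y|\ \forall x,y\ge0\}$; $\mathcal L(U)$ denotes the law of $U$. *)

theory Defs
  imports "HOL-Probability.Probability"
begin

text \<open>
  Laws on the half-line are represented by measures on \<^typ>\<open>real\<close>.  A test function is only
  constrained on \<^term>\<open>{0..} :: real set\<close> and may be non-measurable on the negative axis, hence the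
  restriction of the integrals to \<^term>\<open>{0..} :: real set\<close>; for laws concentrated there they are the
  full expectations.  The supremum is taken in the extended non-negative reals, so that an
  unbounded family of differences yields infinity.
\<close>

definition wasserstein_dist :: "real measure \<Rightarrow> real measure \<Rightarrow> ennreal" where
  "wasserstein_dist P Q =
     (SUP h\<in>{h. 1-lipschitz_on {0..} h}.
        ennreal \<bar>(LINT x:{0..}|P. h x) - (LINT x:{0..}|Q. h x)\<bar>)"

text \<open>
  The summands \<open>X\<^sub>1, X\<^sub>2, \<dots>\<close> are \<open>X 0, X 1, \<dots>\<close>.  The constant \<^const>\<open>geometric_pmf\<close> counts failures:
  the value \<open>k\<close> has probability \<open>p * (1 - p) ^ k\<close>, for every \<open>k \<ge> 0\<close>.
  Independence of \<open>N\<close> from the whole sequence is independence of the generated sigma-algebras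
  (the library predicate for two random variables requires a common value type).
\<close>

locale geometric_sum = prob_space M for M :: "'a measure" +
  fixes \<nu> :: "real measure" and p :: real
    and X :: "nat \<Rightarrow> 'a \<Rightarrow> real" and N :: "'a \<Rightarrow> nat"
  assumes indep_X: "indep_vars (\<lambda>_. borel) X UNIV"
    and law_X: "\<And>i. distr M borel (X i) = \<nu>"
    and measurable_N: "random_variable (count_space UNIV) N"
    and law_N: "distr M (count_space UNIV) N = measure_pmf (geometric_pmf p)"
    and indep_N_X:
      "indep_set
         (sets (vimage_algebra (space M) N (count_space UNIV)))
         (sets (vimage_algebra (space M) (\<lambda>\<omega> i. X i \<omega>) (\<Pi>\<^sub>M i\<in>UNIV. borel)))"

text \<open>
  The coordinate realisation of \<open>(N, (X\<^sub>1, X\<^sub>2, \<dots>))\<close>, determined by \<open>\<nu>\<close> and \<open>p\<close> alone.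
\<close>

definition geometric_sum_space :: "real measure \<Rightarrow> real \<Rightarrow> (nat \<times> (nat \<Rightarrow> real)) measure" where
  "geometric_sum_space \<nu> p = measure_pmf (geometric_pmf p) \<Otimes>\<^sub>M (\<Pi>\<^sub>M i\<in>UNIV. \<nu>)"

context geometric_sum
begin

lemma measurable_X [measurable]: "X i \<in> borel_measurable M"
  using indep_X by (auto simp: indep_vars_def)

lemma measurable_seq [measurable]: "(\<lambda>\<omega> i. X i \<omega>) \<in> M \<rightarrow>\<^sub>M (\<Pi>\<^sub>M i\<in>UNIV. borel)"
  by (rule measurable_PiM_single') (auto simp: space_PiM)

lemma sets_nu: "sets \<nu> = sets borel"
  using law_X[of 0] by auto

lemma law_seq: "distr M (\<Pi>\<^sub>M i\<in>UNIV. borel) (\<lambda>\<omega> i. X i \<omega>) = (\<Pi>\<^sub>M i\<in>UNIV. \<nu>)"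
  using indep_X indep_vars_iff_distr_eq_PiM[where I = "UNIV :: nat set" and M' = "\<lambda>_. borel" and X = X]
  by (simp add: law_X restrict_UNIV)

lemma joint_law:
  "distr M (count_space UNIV \<Otimes>\<^sub>M (\<Pi>\<^sub>M i\<in>UNIV. borel)) (\<lambda>\<omega>. (N \<omega>, \<lambda>i. X i \<omega>)) =
   geometric_sum_space \<nu> p"
  unfolding geometric_sum_space_def
proof (rule pair_measure_eqI [symmetric])
  note [measurable] = measurable_N
  interpret nu: prob_space \<nu>
    using law_X[of 0] prob_space_distr[OF measurable_X] by metis
  interpret P: product_prob_space "\<lambda>_::nat. \<nu>" UNIV ..
  show "sigma_finite_measure (measure_pmf (geometric_pmf p))"
    by unfold_locales
  show "sigma_finite_measure (\<Pi>\<^sub>M i\<in>(UNIV :: nat set). \<nu>)"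
    by unfold_locales
  show "sets (measure_pmf (geometric_pmf p) \<Otimes>\<^sub>M (\<Pi>\<^sub>M i\<in>UNIV. \<nu>)) =
    sets (distr M (count_space UNIV \<Otimes>\<^sub>M (\<Pi>\<^sub>M i\<in>UNIV. borel)) (\<lambda>\<omega>. (N \<omega>, \<lambda>i. X i \<omega>)))"
    by (auto intro!: sets_pair_measure_cong sets_PiM_cong simp: sets_nu)
  fix A B
  assume "A \<in> sets (measure_pmf (geometric_pmf p))" "B \<in> sets (\<Pi>\<^sub>M i\<in>(UNIV :: nat set). \<nu>)"
  moreover have "sets (\<Pi>\<^sub>M i\<in>(UNIV :: nat set). \<nu>) = sets (\<Pi>\<^sub>M i\<in>(UNIV :: nat set). borel)"
    by (intro sets_PiM_cong) (auto simp: sets_nu)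
  ultimately have A [measurable]: "A \<in> sets (count_space UNIV)"
    and B [measurable]: "B \<in> sets (\<Pi>\<^sub>M i\<in>(UNIV :: nat set). borel)"
    by auto
  have "prob ((N -` A \<inter> space M) \<inter> ((\<lambda>\<omega> i. X i \<omega>) -` B \<inter> space M)) =
    prob (N -` A \<inter> space M) * prob ((\<lambda>\<omega> i. X i \<omega>) -` B \<inter> space M)"
    by (rule indep_setD[OF indep_N_X]) (use A B in \<open>auto intro: in_vimage_algebra\<close>)
  moreover have "(N -` A \<inter> space M) \<inter> ((\<lambda>\<omega> i. X i \<omega>) -` B \<inter> space M) =
    (\<lambda>\<omega>. (N \<omega>, \<lambda>i. X i \<omega>)) -` (A \<times> B) \<inter> space M"
    by auto
  moreover have "emeasure (measure_pmf (geometric_pmf p)) A = emeasure M (N -` A \<inter> space M)"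
    unfolding law_N[symmetric] by (rule emeasure_distr) measurable
  moreover have "emeasure (\<Pi>\<^sub>M i\<in>UNIV. \<nu>) B = emeasure M ((\<lambda>\<omega> i. X i \<omega>) -` B \<inter> space M)"
    unfolding law_seq[symmetric] by (rule emeasure_distr) measurable
  moreover have "emeasure (distr M (count_space UNIV \<Otimes>\<^sub>M (\<Pi>\<^sub>M i\<in>UNIV. borel))
      (\<lambda>\<omega>. (N \<omega>, \<lambda>i. X i \<omega>))) (A \<times> B) =
    emeasure M ((\<lambda>\<omega>. (N \<omega>, \<lambda>i. X i \<omega>)) -` (A \<times> B) \<inter> space M)"
    by (rule emeasure_distr) measurable
  ultimately show "emeasure (measure_pmf (geometric_pmf p)) A * emeasure (\<Pi>\<^sub>M i\<in>UNIV. \<nu>) B =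
    emeasure (distr M (count_space UNIV \<Otimes>\<^sub>M (\<Pi>\<^sub>M i\<in>UNIV. borel))
      (\<lambda>\<omega>. (N \<omega>, \<lambda>i. X i \<omega>))) (A \<times> B)"
    by (simp add: emeasure_eq_measure ennreal_mult)
qed

text \<open>The law of \<open>W\<close> is that of its coordinate realisation.\<close>

lemma law_scaled_sum:
  "distr M borel (\<lambda>\<omega>. a * (\<Sum>i<N \<omega>. X i \<omega>)) =
   distr (geometric_sum_space \<nu> p) borel (\<lambda>\<omega>. a * (\<Sum>i<fst \<omega>. snd \<omega> i))"
proof -
  note [measurable] = measurable_N
  have [measurable]: "(\<lambda>\<omega>. a * (\<Sum>i<fst \<omega>. snd \<omega> i)) \<in>
      count_space UNIV \<Otimes>\<^sub>M (\<Pi>\<^sub>M i\<in>(UNIV :: nat set). (borel :: real measure)) \<rightarrow>\<^sub>M borel"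
  proof (rule measurable_compose_countable'[where I = UNIV and g = fst])
    show "(\<lambda>\<omega>. a * (\<Sum>i<n. snd \<omega> i)) \<in>
      count_space (UNIV :: nat set) \<Otimes>\<^sub>M (\<Pi>\<^sub>M i\<in>(UNIV :: nat set). (borel :: real measure)) \<rightarrow>\<^sub>M borel"
      for n :: nat
      by measurable
  qed auto
  show ?thesis
    unfolding joint_law[symmetric] by (subst distr_distr) (auto simp: comp_def)
qed

end

lemma geometric_sum_geometric_sum_space:
  assumes "prob_space \<nu>" and sets_nu: "sets \<nu> = sets borel"
  shows "geometric_sum (geometric_sum_space \<nu> p) \<nu> p (\<lambda>i \<omega>. snd \<omega> i) fst"
proof -
  interpret nu: prob_space \<nu> by fact
  let ?G = "measure_pmf (geometric_pmf p)" and ?P = "\<Pi>\<^sub>M i\<in>(UNIV :: nat set). \<nu>"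
  interpret P: product_prob_space "\<lambda>_::nat. \<nu>" UNIV ..
  interpret GP: pair_prob_space ?G ?P ..
  have sets_P: "sets ?P = sets (\<Pi>\<^sub>M i\<in>(UNIV :: nat set). borel)"
    by (intro sets_PiM_cong) (auto simp: sets_nu)
  have space_P: "space ?P = UNIV"
    using sets_eq_imp_space_eq[OF sets_P] by (simp add: space_PiM)
  have law_fst: "distr (?G \<Otimes>\<^sub>M ?P) ?G fst = ?G"
    by (rule P.distr_pair_fst)
  have law_snd: "distr (?G \<Otimes>\<^sub>M ?P) ?P snd = ?P"
  proof (rule measure_eqI)
    fix B assume "B \<in> sets (distr (?G \<Otimes>\<^sub>M ?P) ?P snd)"
    hence B: "B \<in> sets ?P" by simp
    have "snd -` B \<inter> space (?G \<Otimes>\<^sub>M ?P) = UNIV \<times> B"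
      by (auto simp: space_pair_measure space_P)
    thus "emeasure (distr (?G \<Otimes>\<^sub>M ?P) ?P snd) B = emeasure ?P B"
      using B by (simp add: emeasure_distr P.emeasure_pair_measure_Times
          measure_pmf.emeasure_space_1[simplified])
  qed simp
  have rv: "(\<lambda>\<omega>. snd \<omega> i) \<in> borel_measurable (?G \<Otimes>\<^sub>M ?P)" for i :: nat
  proof -
    have "(\<lambda>\<omega>. snd \<omega> i) \<in> ?G \<Otimes>\<^sub>M ?P \<rightarrow>\<^sub>M \<nu>" by (rule measurable_compose[OF measurable_snd measurable_component_singleton]) simp
    thus ?thesis by (subst (asm) measurable_cong_sets[OF refl sets_nu])
  qed
  have law_i: "distr (?G \<Otimes>\<^sub>M ?P) borel (\<lambda>\<omega>. snd \<omega> i) = \<nu>" for i :: nat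
  proof -
    have "distr (?G \<Otimes>\<^sub>M ?P) borel (\<lambda>\<omega>. snd \<omega> i) = distr (?G \<Otimes>\<^sub>M ?P) \<nu> (\<lambda>\<omega>. snd \<omega> i)"
      by (rule distr_cong) (auto simp: sets_nu)
    also have "\<dots> = distr (distr (?G \<Otimes>\<^sub>M ?P) ?P snd) \<nu> (\<lambda>x. x i)"
      by (subst distr_distr) (auto simp: comp_def)
    also have "\<dots> = \<nu>"
      unfolding law_snd by (rule P.PiM_component) simp
    finally show ?thesis .
  qed
  have law_all: "distr (?G \<Otimes>\<^sub>M ?P) (\<Pi>\<^sub>M i\<in>(UNIV :: nat set). borel) (\<lambda>\<omega> i. snd \<omega> i) = ?P"
  proof -
    have "distr (?G \<Otimes>\<^sub>M ?P) (\<Pi>\<^sub>M i\<in>(UNIV :: nat set). borel) (\<lambda>\<omega> i. snd \<omega> i) =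
      distr (?G \<Otimes>\<^sub>M ?P) ?P snd"
      by (rule distr_cong) (auto simp: sets_P)
    thus ?thesis by (simp add: law_snd)
  qed
  show ?thesis
    unfolding geometric_sum_space_def
  proof unfold_locales
    show "GP.indep_vars (\<lambda>_. borel) (\<lambda>i \<omega>. snd \<omega> i) UNIV"
      by (subst GP.indep_vars_iff_distr_eq_PiM) (auto simp: rv law_i law_all restrict_UNIV)
    show "distr (?G \<Otimes>\<^sub>M ?P) borel (\<lambda>\<omega>. snd \<omega> i) = \<nu>" for i
      by (rule law_i)
    show "fst \<in> ?G \<Otimes>\<^sub>M ?P \<rightarrow>\<^sub>M count_space UNIV"
      using measurable_fst[of ?G ?P] by simp
    have "distr (?G \<Otimes>\<^sub>M ?P) (count_space UNIV) fst = distr (?G \<Otimes>\<^sub>M ?P) ?G fst"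
      by (rule distr_cong) auto
    thus "distr (?G \<Otimes>\<^sub>M ?P) (count_space UNIV) fst = ?G"
      by (simp add: law_fst)
    have split: "GP.prob (a \<inter> b) = GP.prob a * GP.prob b"
      if "a \<in> sets (vimage_algebra (space (?G \<Otimes>\<^sub>M ?P)) fst (count_space UNIV))"
        "b \<in> sets (vimage_algebra (space (?G \<Otimes>\<^sub>M ?P)) (\<lambda>\<omega> i. snd \<omega> i) (\<Pi>\<^sub>M i\<in>UNIV. borel))"
      for a b
    proof -
      have "a \<in> {fst -` A \<inter> space (?G \<Otimes>\<^sub>M ?P) | A. A \<in> sets (count_space UNIV)}"
        using that(1) by (subst (asm) sets_vimage_algebra2) auto
      then obtain A where "a = fst -` A \<inter> space (?G \<Otimes>\<^sub>M ?P)"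
        by blast
      hence a: "a = A \<times> UNIV"
        by (auto simp: space_pair_measure space_P)
      have "b \<in> {(\<lambda>\<omega>. snd \<omega>) -` B \<inter> space (?G \<Otimes>\<^sub>M ?P) | B.
          B \<in> sets (\<Pi>\<^sub>M i\<in>(UNIV :: nat set). (borel :: real measure))}"
        using that(2) by (subst (asm) sets_vimage_algebra2) (auto simp: space_PiM)
      then obtain B where "b = snd -` B \<inter> space (?G \<Otimes>\<^sub>M ?P)" and B: "B \<in> sets ?P"
        unfolding sets_P by blast
      hence b: "b = UNIV \<times> B"
        by (auto simp: space_pair_measure space_P)
      have ab: "a \<inter> b = A \<times> B" by (auto simp: a b)
      have U: "UNIV \<in> sets ?P" "emeasure ?P UNIV = 1"
        using sets.top[of ?P] P.emeasure_space_1 by (auto simp: space_P)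
      have "emeasure (?G \<Otimes>\<^sub>M ?P) (a \<inter> b) = emeasure (?G \<Otimes>\<^sub>M ?P) a * emeasure (?G \<Otimes>\<^sub>M ?P) b"
        unfolding ab unfolding a b using B U
        by (simp add: P.emeasure_pair_measure_Times measure_pmf.emeasure_space_1[simplified])
      thus ?thesis
        by (simp add: measure_def enn2real_mult)
    qed
    show "GP.indep_set (sets (vimage_algebra (space (?G \<Otimes>\<^sub>M ?P)) fst (count_space UNIV)))
      (sets (vimage_algebra (space (?G \<Otimes>\<^sub>M ?P)) (\<lambda>\<omega> i. snd \<omega> i) (\<Pi>\<^sub>M i\<in>UNIV. borel)))"
    proof (rule GP.indep_setI)
      show "sets (vimage_algebra (space (?G \<Otimes>\<^sub>M ?P)) fst (count_space UNIV)) \<subseteq> sets (?G \<Otimes>\<^sub>M ?P)"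
        by (intro sets_image_in_sets) (use measurable_fst[of ?G ?P] in simp_all)
      show "sets (vimage_algebra (space (?G \<Otimes>\<^sub>M ?P)) (\<lambda>\<omega> i. snd \<omega> i) (\<Pi>\<^sub>M i\<in>UNIV. borel))
        \<subseteq> sets (?G \<Otimes>\<^sub>M ?P)"
      proof (intro sets_image_in_sets)
        show "(\<lambda>\<omega> i. snd \<omega> i) \<in> ?G \<Otimes>\<^sub>M ?P \<rightarrow>\<^sub>M (\<Pi>\<^sub>M i\<in>UNIV. borel)"
          using measurable_snd[of ?G ?P]
          by (subst (asm) measurable_cong_sets[OF refl sets_P])
      qed simp_all
    qed (rule split)
  qed
qed

end

theory Submission
  imports Defs
begin

text \<open>
  Let \<open>T h x = E h (x + Z)\<close>.  For a 1-Lipschitz \<open>h\<close> the function \<open>f = E h Z - T h\<close> solves Stein's equation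
  \<open>f' - f = h - E h Z\<close> with \<open>f 0 = 0\<close>, and \<open>f' = h - T h\<close> is visibly 2-Lipschitz.  With \<open>q = 1 - p\<close> and
  \<open>a = p / (q \<mu>)\<close>, the law of \<open>W\<close> is a fixed point: \<open>W\<close> is \<open>0\<close> with probability \<open>p\<close> and distributed as
  \<open>a X + W\<close>, with independent summands, with probability \<open>q\<close>.  Hence
  \<open>p E f W = q E (f (W + a X) - f W)\<close>, and a Taylor expansion turns the right-hand side into
  \<open>p E f' W\<close> up to an error of at most \<open>q a\<^sup>2 E X\<^sup>2\<close>.  Dividing by \<open>p\<close> gives the upper bound.

  For the lower bound take \<open>h x = exp (- x)\<close>.  The fixed point gives \<open>E h W = p / (1 - q \<phi>)\<close> with
  \<open>\<phi> = E exp (- a X)\<close>, which is at least \<open>exp (- p / q)\<close> by Jensen's inequality; this exceeds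
  \<open>E h Z = 1 / 2\<close> by at least \<open>p / 16\<close>.
\<close>

section \<open>Products of functions of independent coordinates\<close>

lemma (in pair_sigma_finite)
  fixes f :: "'a \<Rightarrow> real" and g :: "'b \<Rightarrow> real"
  assumes f: "integrable M1 f" and g: "integrable M2 g"
  shows integrable_times_pair: "integrable (M1 \<Otimes>\<^sub>M M2) (\<lambda>z. f (fst z) * g (snd z))"
    and integral_times_pair:
      "(\<integral>z. f (fst z) * g (snd z) \<partial>(M1 \<Otimes>\<^sub>M M2)) = (\<integral>x. f x \<partial>M1) * (\<integral>y. g y \<partial>M2)"
proof -
  have [measurable]: "f \<in> borel_measurable M1" "g \<in> borel_measurable M2"
    using f g by auto
  show int: "integrable (M1 \<Otimes>\<^sub>M M2) (\<lambda>z. f (fst z) * g (snd z))"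
  proof (rule Fubini_integrable)
    show "integrable M1 (\<lambda>x. \<integral>y. norm (f (fst (x, y)) * g (snd (x, y))) \<partial>M2)"
      using f g by (simp add: abs_mult)
    show "AE x in M1. integrable M2 (\<lambda>y. f (fst (x, y)) * g (snd (x, y)))"
      using g by simp
  qed measurable
  show "(\<integral>z. f (fst z) * g (snd z) \<partial>(M1 \<Otimes>\<^sub>M M2)) = (\<integral>x. f x \<partial>M1) * (\<integral>y. g y \<partial>M2)"
    using integral_fst'[OF int] by simp
qed

subsection \<open>Stein's equation for the exponential law\<close>

lemma integrable_lipschitz:
  fixes h :: "real \<Rightarrow> real"
  assumes h: "C-lipschitz_on UNIV h" and P: "finite_measure P" "sets P = sets borel"
    and int: "integrable P (\<lambda>x. x)"
  shows "integrable P h"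
proof -
  interpret finite_measure P by fact
  have [measurable]: "h \<in> borel_measurable P"
    using borel_measurable_continuous_onI[OF lipschitz_on_continuous_on[OF h]] P(2)
    by (simp cong: measurable_cong_sets)
  have "integrable P (\<lambda>x. \<bar>h 0\<bar> + C * \<bar>x\<bar>)"
    using int by (intro Bochner_Integration.integrable_add integrable_mult_right) auto
  thus ?thesis
  proof (rule Bochner_Integration.integrable_bound)
    have "\<bar>h x\<bar> \<le> \<bar>h 0\<bar> + C * \<bar>x\<bar>" for x
      using lipschitz_onD[OF h, of x 0] by (auto simp: dist_real_def)
    moreover have "0 \<le> C" by (rule lipschitz_on_nonneg[OF h])
    ultimately show "AE x in P. norm (h x) \<le> norm (\<bar>h 0\<bar> + C * \<bar>x\<bar>)" by simp
  qed measurable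
qed

section \<open>The unit exponential law\<close>

abbreviation exponential_law :: "real measure" where
  "exponential_law \<equiv> density lborel (exponential_density 1)"

interpretation exponential_law: prob_space exponential_law
  by (rule prob_space_exponential_density) simp

lemma exponential_law_id: "distributed exponential_law lborel (\<lambda>z. z) (exponential_density 1)"
  by (auto simp: distributed_def distr_id2)

lemma integrable_exponential_law: "integrable exponential_law (\<lambda>z. z)"
  using exponential_law.erlang_ith_moment_integrable[OF _ exponential_law_id, of 1] by simp

lemma AE_exponential_law_nonneg: "AE z in exponential_law. 0 \<le> z"
  by (subst AE_density) (auto simp: exponential_density_def)

lemma integral_exponential_law:
  assumes [measurable]: "f \<in> borel_measurable borel"
  shows "(\<integral>z. f z \<partial>exponential_law) = (\<integral>z. indicator {0<..} z * (exp (- z) * f z) \<partial>lborel)"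
proof -
  have "(\<integral>z. f z \<partial>exponential_law) = (\<integral>z. exponential_density 1 z * f z \<partial>lborel)"
    by (subst integral_density) (auto simp: exponential_density_nonneg)
  also have "\<dots> = (\<integral>z. indicator {0<..} z * (exp (- z) * f z) \<partial>lborel)"
  proof (rule integral_cong_AE)
    \<comment> \<open>At 0 the density is 1 but the indicator of the open half-line is 0; the
      integrands can differ only at this null point.\<close>
    show "AE z in lborel. exponential_density 1 z * f z = indicator {0<..} z * (exp (- z) * f z)"
      using AE_lborel_singleton[of 0]
      by eventually_elim (auto simp: exponential_density_def indicator_def)
  qed measurable
  finally show ?thesis .
qed

text \<open>\<open>exp (- z)\<close> times the density of rate 1 is half the density of rate 2,
  which has total mass 1.\<close>

lemma laplace_exponential_law: "(\<integral>z. exp (- z) \<partial>exponential_law) = 1 / 2"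
proof -
  interpret E2: prob_space "density lborel (exponential_density 2)"
    by (rule prob_space_exponential_density) simp
  have "(\<integral>z. exp (- z) \<partial>exponential_law) = (\<integral>z. exponential_density 1 z * exp (- z) \<partial>lborel)"
    by (subst integral_density) (auto simp: exponential_density_nonneg)
  also have "\<dots> = (\<integral>z. exponential_density 2 z * (1 / 2) \<partial>lborel)"
    by (intro Bochner_Integration.integral_cong)
       (auto simp: exponential_density_def simp flip: exp_add)
  also have "\<dots> = (\<integral>z. 1 / 2 \<partial>density lborel (exponential_density 2))"
    by (subst integral_density) (auto simp: exponential_density_nonneg)
  also have "\<dots> = 1 / 2"
    using E2.prob_space by (simp del: space_density)
  finally show ?thesis .
qed

section \<open>Averaging a Lipschitz function over exponential shifts\<close>

locale exponential_stein =
  fixes h :: "real \<Rightarrow> real"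
  assumes lip: "1-lipschitz_on UNIV h"
begin

text \<open>This is \<open>T h\<close> of the overview: \<open>shift_mean 0\<close> is the
  exponential mean of \<open>h\<close>, and the Stein solution at \<open>x\<close> is
  \<open>shift_mean 0 - shift_mean x\<close>.\<close>

definition shift_mean :: "real \<Rightarrow> real" where
  "shift_mean x = (\<integral>z. h (x + z) \<partial>exponential_law)"

lemma abs_diff_h: "\<bar>h x - h y\<bar> \<le> \<bar>x - y\<bar>"
  using lipschitz_onD[OF lip, of x y] by (simp add: dist_real_def)

lemma continuous_h: "continuous_on A h"
  using lipschitz_on_continuous_on[OF lip] continuous_on_subset by blast

lemma measurable_h [measurable]: "h \<in> borel_measurable borel"
  by (rule borel_measurable_continuous_onI[OF continuous_h])

lemma integrable_h_shift: "integrable exponential_law (\<lambda>z. h (x + z))"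
proof (rule integrable_lipschitz)
  show "1-lipschitz_on UNIV (\<lambda>z. h (x + z))"
    by (rule lipschitz_onI) (use abs_diff_h[of "x + _" "x + _"] in \<open>auto simp: dist_real_def\<close>)
qed (auto intro: exponential_law.finite_measure_axioms integrable_exponential_law)

lemma abs_diff_shift_mean: "\<bar>shift_mean x - shift_mean y\<bar> \<le> \<bar>x - y\<bar>"
proof -
  have "\<bar>shift_mean x - shift_mean y\<bar> = \<bar>\<integral>z. h (x + z) - h (y + z) \<partial>exponential_law\<bar>"
    by (simp add: shift_mean_def integrable_h_shift)
  also have "\<dots> \<le> (\<integral>z. \<bar>h (x + z) - h (y + z)\<bar> \<partial>exponential_law)"
    by (rule integral_abs_bound)
  also have "\<dots> \<le> (\<integral>z. \<bar>x - y\<bar> \<partial>exponential_law)"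
    by (intro integral_mono)
       (auto simp: integrable_h_shift intro: order_trans[OF abs_diff_h])
  also have "\<dots> = \<bar>x - y\<bar>"
    using exponential_law.prob_space by (simp del: space_density)
  finally show ?thesis .
qed

lemma lipschitz_shift_mean: "1-lipschitz_on UNIV shift_mean"
  by (rule lipschitz_onI) (use abs_diff_shift_mean in \<open>auto simp: dist_real_def\<close>)

text \<open>The substitution \<open>t = x + z\<close> moves \<open>x\<close> out of the argument of
  \<open>h\<close>, which may fail to be differentiable, into an exponential factor and a limit of
  integration.\<close>

lemma shift_mean_eq_tail: "shift_mean x = exp x * (LINT t:{x<..}|lborel. exp (- t) * h t)"
proof -
  have "shift_mean x = (\<integral>z. indicator {0<..} z * (exp (- z) * h (x + z)) \<partial>lborel)"
    unfolding shift_mean_def by (rule integral_exponential_law) measurable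
  also have "\<dots> = (\<integral>z. exp x * (indicator {x<..} (x + 1 * z) * (exp (- (x + 1 * z)) * h (x + 1 * z))) \<partial>lborel)"
    by (intro Bochner_Integration.integral_cong)
       (auto simp: indicator_def mult.assoc[symmetric] simp flip: exp_add)
  also have "\<dots> = exp x * (LINT t:{x<..}|lborel. exp (- t) * h t)"
    using lborel_integral_real_affine[of 1 "\<lambda>t. indicator {x<..} t * (exp (- t) * h t)" x]
    by (simp add: set_lebesgue_integral_def)
  finally show ?thesis .
qed

lemma set_integrable_tail: "set_integrable lborel {x<..} (\<lambda>t. exp (- t) * h t)"
proof -
  let ?f = "\<lambda>t. indicator {x<..} t * (exp (- t) * h t)"
  have "integrable lborel (\<lambda>z. exponential_density 1 z * h (x + z))"
    using integrable_h_shift[of x]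
    by (subst (asm) integrable_density) (auto simp: exponential_density_nonneg)
  \<comment> \<open>The indicator discards \<open>z = 0\<close>, so that the function equality below
    holds at every point and not only almost everywhere.\<close>
  hence "integrable lborel (\<lambda>z. indicator {0<..} z *\<^sub>R (exponential_density 1 z * h (x + z)))"
    by (intro integrable_mult_indicator) auto
  hence "integrable lborel
      (\<lambda>z. exp (- x) * (indicator {0<..} z *\<^sub>R (exponential_density 1 z * h (x + z))))"
    by (rule integrable_mult_right)
  also have "(\<lambda>z. exp (- x) * (indicator {0<..} z *\<^sub>R (exponential_density 1 z * h (x + z)))) =
      (\<lambda>z. ?f (x + 1 * z))"
    by (auto simp: fun_eq_iff exponential_density_def indicator_def exp_diff exp_minus field_simps)
  finally have "integrable lborel ?f"
    by (subst (asm) lborel_integrable_real_affine_iff) simp_all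
  thus ?thesis
    by (simp add: set_integrable_def)
qed

text \<open>Measuring the tail from a fixed base \<open>b\<close> leaves a constant and an integral
  over a compact interval, to which the fundamental theorem of calculus applies.\<close>

lemma shift_mean_eq_base:
  assumes "b \<le> x"
  shows "shift_mean x = exp x * ((LINT t:{b<..}|lborel. exp (- t) * h t) - integral {b..x} (\<lambda>t. exp (- t) * h t))"
proof -
  let ?k = "\<lambda>t. exp (- t) * h t"
  have int: "set_integrable lborel {b..x} ?k"
    unfolding set_integrable_def
    by (rule borel_integrable_compact) (auto intro!: continuous_intros continuous_h)
  have "(LINT t:{b<..}|lborel. ?k t) = (LINT t:{b<..x} \<union> {x<..}|lborel. ?k t)"
    using assms by (simp add: ivl_disj_un)
  also have "\<dots> = (LINT t:{b<..x}|lborel. ?k t) + (LINT t:{x<..}|lborel. ?k t)"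
    by (intro set_integral_Un set_integrable_subset[OF int] set_integrable_tail) auto
  also have "(LINT t:{b<..x}|lborel. ?k t) = (LINT t:{b..x}|lborel. ?k t)"
    unfolding set_lebesgue_integral_def
  proof (rule integral_cong_AE)
    show "AE t in lborel. indicator {b<..x} t *\<^sub>R ?k t = indicator {b..x} t *\<^sub>R ?k t"
      using AE_lborel_singleton[of b] by eventually_elim (auto simp: indicator_def)
  qed measurable
  also have "\<dots> = integral {b..x} ?k"
    by (rule set_borel_integral_eq_integral(2)[OF int])
  finally show ?thesis by (simp add: shift_mean_eq_tail)
qed

text \<open>By the product rule the exponential factor reproduces \<open>shift_mean x\<close>, while
  the integral contributes \<open>- h x\<close> because \<open>exp x\<close> and
  \<open>exp (- x)\<close> cancel. For the Stein solution this is Stein's equation.\<close>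

lemma shift_mean_has_derivative: "(shift_mean has_real_derivative shift_mean x - h x) (at x)"
proof -
  define k where "k = (\<lambda>t. exp (- t) * h t)"
  \<comment> \<open>A base strictly to the left makes \<open>x\<close> an interior point, so the
    derivative within the interval is two-sided.\<close>
  define b where "b = x - 1"
  define C where "C = (LINT t:{b<..}|lborel. k t)"
  let ?F = "\<lambda>y. exp y * (C - integral {b..y} k)"
  have F: "shift_mean y = ?F y" if "b \<le> y" for y
    using shift_mean_eq_base[OF that] by (simp add: C_def k_def)
  have "((\<lambda>y. integral {b..y} k) has_real_derivative k x) (at x within {b..x+1})"
    by (rule integral_has_real_derivative)
       (auto simp: b_def k_def intro!: continuous_intros continuous_h)
  moreover have "at x within {b..x+1} = at x"
    by (rule at_within_Icc_at) (auto simp: b_def)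
  ultimately have D: "((\<lambda>y. integral {b..y} k) has_real_derivative k x) (at x)"
    by simp
  have "(?F has_real_derivative exp x * (C - integral {b..x} k) + exp x * (0 - k x)) (at x)"
    by (auto intro!: derivative_eq_intros D)
  also have "exp x * (C - integral {b..x} k) + exp x * (0 - k x) = shift_mean x - h x"
    by (subst F) (auto simp: b_def k_def exp_minus)
  finally have "(?F has_real_derivative shift_mean x - h x) (at x)" .
  thus ?thesis
  proof (rule has_field_derivative_transform_within_open)
    show "open {b<..}" "x \<in> {b<..}" by (auto simp: b_def)
  qed (simp add: F)
qed

text \<open>The derivative of the Stein solution is 2-Lipschitz, so the first-order Taylor remainder
  grows at rate at most \<open>2 * s\<close>, which integrates to \<open>y\<^sup>2\<close>.\<close>

lemma taylor_shift_mean: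
  assumes "0 \<le> y"
  shows "\<bar>shift_mean x - shift_mean (x + y) - y * (h x - shift_mean x)\<bar> \<le> y\<^sup>2"
proof -
  let ?\<phi> = "\<lambda>s. shift_mean x - shift_mean (x + s) - s * (h x - shift_mean x)"
  have D: "(?\<phi> has_real_derivative (h (x + s) - shift_mean (x + s)) - (h x - shift_mean x)) (at s)" for s
  proof -
    have "((\<lambda>s. shift_mean (x + s)) has_real_derivative shift_mean (x + s) - h (x + s)) (at s)"
      using shift_mean_has_derivative[of "x + s"] by (simp add: DERIV_shift add.commute)
    thus ?thesis by (auto intro!: derivative_eq_intros)
  qed
  have bd: "\<bar>(h (x + s) - shift_mean (x + s)) - (h x - shift_mean x)\<bar> \<le> 2 * s" if "0 \<le> s" for s
    using abs_diff_h[of "x + s" x] abs_diff_shift_mean[of "x + s" x] that by linarith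
  \<comment> \<open>\<open>s\<^sup>2 + ?\<phi> s\<close> and \<open>s\<^sup>2 - ?\<phi> s\<close>
    vanish at 0 and are nondecreasing; this gives the two sides of the absolute bound.\<close>
  have "0\<^sup>2 + ?\<phi> 0 \<le> y\<^sup>2 + ?\<phi> y"
  proof (rule DERIV_nonneg_imp_nondecreasing[OF assms])
    fix s assume "0 \<le> s" "s \<le> y"
    moreover have "((\<lambda>s. s\<^sup>2 + ?\<phi> s) has_real_derivative
      2 * s + ((h (x + s) - shift_mean (x + s)) - (h x - shift_mean x))) (at s)"
      by (rule DERIV_add[OF _ D]) (auto intro!: derivative_eq_intros)
    ultimately show "\<exists>d. ((\<lambda>s. s\<^sup>2 + ?\<phi> s) has_real_derivative d) (at s) \<and> 0 \<le> d"
      using bd[of s] by (intro exI[of _ "2 * s + ((h (x + s) - shift_mean (x + s)) - (h x - shift_mean x))"] conjI) auto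
  qed
  moreover have "0\<^sup>2 - ?\<phi> 0 \<le> y\<^sup>2 - ?\<phi> y"
  proof (rule DERIV_nonneg_imp_nondecreasing[OF assms])
    fix s assume "0 \<le> s" "s \<le> y"
    moreover have "((\<lambda>s. s\<^sup>2 - ?\<phi> s) has_real_derivative
      2 * s - ((h (x + s) - shift_mean (x + s)) - (h x - shift_mean x))) (at s)"
      by (rule DERIV_diff[OF _ D]) (auto intro!: derivative_eq_intros)
    ultimately show "\<exists>d. ((\<lambda>s. s\<^sup>2 - ?\<phi> s) has_real_derivative d) (at s) \<and> 0 \<le> d"
      using bd[of s] by (intro exI[of _ "2 * s - ((h (x + s) - shift_mean (x + s)) - (h x - shift_mean x))"] conjI) auto
  qed
  ultimately show ?thesis by simp
qed

end

subsection \<open>The law of a scaled geometric sum\<close>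

text \<open>The scale \<open>a\<close> stays free because the fixed point holds for every scale; the
  normalisation enters only through the later assumption \<open>scale\<close>.\<close>

locale geometric_sum_law = nu: prob_space \<nu> for \<nu> :: "real measure" +
  fixes p a :: real
  assumes sets_nu [measurable_cong]: "sets \<nu> = sets borel"
    and p_pos: "0 < p" and p_less_1: "p < 1"
begin

sublocale seq: sequence_space \<nu> ..

definition L :: "real measure" where
  "L = distr (geometric_sum_space \<nu> p) borel (\<lambda>\<omega>. a * (\<Sum>i<fst \<omega>. snd \<omega> i))"

lemma measurable_scaled_sum [measurable]:
  "(\<lambda>\<omega>. a * (\<Sum>i<fst \<omega>. snd \<omega> i)) \<in>
     borel_measurable (measure_pmf (geometric_pmf p) \<Otimes>\<^sub>M (\<Pi>\<^sub>M i\<in>(UNIV :: nat set). \<nu>))"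
proof (rule measurable_compose_countable'[where I = UNIV and g = fst])
  show "(\<lambda>\<omega>. a * (\<Sum>i<n. snd \<omega> i)) \<in>
     borel_measurable (measure_pmf (geometric_pmf p) \<Otimes>\<^sub>M (\<Pi>\<^sub>M i\<in>(UNIV :: nat set). \<nu>))" for n :: nat
    by measurable
qed auto

lemma sets_L [simp, measurable_cong]: "sets L = sets borel"
  by (simp add: L_def)

lemma nn_integral_L:
  assumes [measurable]: "f \<in> borel_measurable borel"
  shows "(\<integral>\<^sup>+w. f w \<partial>L) =
    (\<integral>\<^sup>+n. \<integral>\<^sup>+x. f (a * (\<Sum>i<n. x i)) \<partial>(\<Pi>\<^sub>M i\<in>UNIV. \<nu>) \<partial>measure_pmf (geometric_pmf p))"
  unfolding L_def geometric_sum_space_def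
  by (subst nn_integral_distr) (auto simp: seq.P.nn_integral_fst[symmetric])

sublocale L: prob_space L
proof
  show "emeasure L (space L) = 1"
    using nn_integral_L[of "\<lambda>_. 1"] 
    by (simp add: seq.P.emeasure_space_1 measure_pmf.emeasure_space_1[simplified])
qed

text \<open>An i.i.d. sequence keeps its law when an independent draw is put in front
  (\<open>PiM_iter\<close>), so splitting off the first summand leaves a fresh sequence.\<close>

lemma nn_integral_sum_Suc:
  assumes [measurable]: "f \<in> borel_measurable borel"
  shows "(\<integral>\<^sup>+x. f (a * (\<Sum>i<Suc n. x i)) \<partial>(\<Pi>\<^sub>M i\<in>UNIV. \<nu>)) =
    (\<integral>\<^sup>+y. \<integral>\<^sup>+x. f (a * y + a * (\<Sum>i<n. x i)) \<partial>(\<Pi>\<^sub>M i\<in>UNIV. \<nu>) \<partial>\<nu>)"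
proof -
  let ?P = "\<Pi>\<^sub>M i\<in>(UNIV :: nat set). \<nu>"
  have "(\<integral>\<^sup>+x. f (a * (\<Sum>i<Suc n. x i)) \<partial>?P) =
    (\<integral>\<^sup>+x. f (a * (\<Sum>i<Suc n. x i)) \<partial>distr (\<nu> \<Otimes>\<^sub>M ?P) ?P (\<lambda>(s, \<omega>). case_nat s \<omega>))"
    by (simp only: seq.PiM_iter)
  also have "\<dots> = (\<integral>\<^sup>+z. f (a * (\<Sum>i<Suc n. case_nat (fst z) (snd z) i)) \<partial>(\<nu> \<Otimes>\<^sub>M ?P))"
    by (subst nn_integral_distr) (auto simp: split_beta')
  also have "\<dots> = (\<integral>\<^sup>+z. f (a * fst z + a * (\<Sum>i<n. snd z i)) \<partial>(\<nu> \<Otimes>\<^sub>M ?P))"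
    by (simp only: sum.lessThan_Suc_shift distrib_left nat.case)
  also have "\<dots> = (\<integral>\<^sup>+y. \<integral>\<^sup>+x. f (a * y + a * (\<Sum>i<n. x i)) \<partial>?P \<partial>\<nu>)"
    by (subst seq.P.nn_integral_fst[symmetric]) auto
  finally show ?thesis .
qed

text \<open>Memorylessness: a geometric count is 0 with probability \<open>p\<close>, the event
  recorded by the Bernoulli coordinate, and otherwise one more than a fresh geometric count. Testing
  on indicators keeps all integrals non-negative, as Tonelli requires.\<close>

lemma L_fixed_point:
  "L = distr (measure_pmf (bernoulli_pmf p) \<Otimes>\<^sub>M (\<nu> \<Otimes>\<^sub>M L)) borel
         (\<lambda>z. if fst z then 0 else a * fst (snd z) + snd (snd z))"
  (is "_ = distr _ _ ?T")
proof (rule measure_eqI)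
  let ?P = "\<Pi>\<^sub>M i\<in>(UNIV :: nat set). \<nu>"
  interpret nuL: pair_prob_space \<nu> L ..
  fix A assume "A \<in> sets L"
  hence [measurable]: "A \<in> sets borel" by simp
  define f :: "real \<Rightarrow> ennreal" where "f = indicator A"
  have [measurable]: "f \<in> borel_measurable borel" by (simp add: f_def)
  have "emeasure L A = (\<integral>\<^sup>+w. f w \<partial>L)"
    by (simp add: f_def)
  also have "\<dots> = (\<integral>\<^sup>+n. \<integral>\<^sup>+x. f (a * (\<Sum>i<n. x i)) \<partial>?P \<partial>measure_pmf (geometric_pmf p))"
    by (rule nn_integral_L) measurable
  also have "\<dots> = f 0 * p + (\<integral>\<^sup>+n. \<integral>\<^sup>+x. f (a * (\<Sum>i<Suc n. x i)) \<partial>?P \<partial>geometric_pmf p) * (1 - p)"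
    using p_pos p_less_1
    by (subst geometric_bind_pmf_unfold)
       (simp_all add: seq.P.emeasure_space_1 del: sum.lessThan_Suc)
  also have "(\<integral>\<^sup>+n. \<integral>\<^sup>+x. f (a * (\<Sum>i<Suc n. x i)) \<partial>?P \<partial>geometric_pmf p) =
    (\<integral>\<^sup>+n. \<integral>\<^sup>+y. \<integral>\<^sup>+x. f (a * y + a * (\<Sum>i<n. x i)) \<partial>?P \<partial>\<nu> \<partial>geometric_pmf p)"
    by (subst nn_integral_sum_Suc) auto
  \<comment> \<open>Exchanging the count with the first summand brings the count and the remaining
    sequence together, and their double integral is one against \<open>L\<close>.\<close>
  also have "\<dots> = (\<integral>\<^sup>+y. \<integral>\<^sup>+n. \<integral>\<^sup>+x. f (a * y + a * (\<Sum>i<n. x i)) \<partial>?P \<partial>geometric_pmf p \<partial>\<nu>)"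
  proof -
    interpret Q: pair_sigma_finite "measure_pmf (geometric_pmf p)" \<nu> ..
    have "(\<lambda>z. \<integral>\<^sup>+x. f (a * snd z + a * (\<Sum>i<fst z. x i)) \<partial>?P)
      \<in> borel_measurable (measure_pmf (geometric_pmf p) \<Otimes>\<^sub>M \<nu>)"
      by (rule measurable_compose_countable'[where I = UNIV and g = fst]) auto
    thus ?thesis by (subst Q.Fubini') (auto simp: split_beta')
  qed
  also have "\<dots> = (\<integral>\<^sup>+y. \<integral>\<^sup>+w. f (a * y + w) \<partial>L \<partial>\<nu>)"
    by (subst nn_integral_L) auto
  also have "\<dots> = (\<integral>\<^sup>+z. f (a * fst z + snd z) \<partial>(\<nu> \<Otimes>\<^sub>M L))"
    by (subst L.nn_integral_fst[symmetric]) auto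
  also have "f 0 * p + (\<integral>\<^sup>+z. f (a * fst z + snd z) \<partial>(\<nu> \<Otimes>\<^sub>M L)) * (1 - p) =
     (\<integral>\<^sup>+b. \<integral>\<^sup>+z. f (?T (b, z)) \<partial>(\<nu> \<Otimes>\<^sub>M L) \<partial>bernoulli_pmf p)"
    using p_pos p_less_1 by (simp add: nuL.emeasure_space_1)
  also have "\<dots> = (\<integral>\<^sup>+z. f (?T z) \<partial>(measure_pmf (bernoulli_pmf p) \<Otimes>\<^sub>M (\<nu> \<Otimes>\<^sub>M L)))"
    by (rule nuL.nn_integral_fst) measurable
  also have "\<dots> = (\<integral>\<^sup>+z. f z \<partial>distr (measure_pmf (bernoulli_pmf p) \<Otimes>\<^sub>M (\<nu> \<Otimes>\<^sub>M L)) borel ?T)"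
    by (subst nn_integral_distr) auto
  also have "\<dots> = emeasure (distr (measure_pmf (bernoulli_pmf p) \<Otimes>\<^sub>M (\<nu> \<Otimes>\<^sub>M L)) borel ?T) A"
    by (simp add: f_def)
  finally show "emeasure L A = \<dots>" .
qed simp

lemma integral_L:
  fixes f :: "real \<Rightarrow> real"
  assumes f: "integrable L f"
  shows "(\<integral>w. f w \<partial>L) = p * f 0 + (1 - p) * (\<integral>z. f (a * fst z + snd z) \<partial>(\<nu> \<Otimes>\<^sub>M L))"
proof -
  let ?B = "measure_pmf (bernoulli_pmf p)"
  let ?T = "\<lambda>z. if fst z then 0 else a * fst (snd z) + snd (snd z)"
  interpret nuL: pair_prob_space \<nu> L ..
  interpret Q: pair_sigma_finite ?B "\<nu> \<Otimes>\<^sub>M L" ..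
  have [measurable]: "f \<in> borel_measurable borel"
    using borel_measurable_integrable[OF f] by simp
  \<comment> \<open>The fixed point also carries integrability over to the product space, which
    Fubini demands.\<close>
  have "integrable (distr (?B \<Otimes>\<^sub>M (\<nu> \<Otimes>\<^sub>M L)) borel ?T) f"
    using f by (subst (asm) L_fixed_point)
  hence int: "integrable (?B \<Otimes>\<^sub>M (\<nu> \<Otimes>\<^sub>M L)) (\<lambda>z. f (?T z))"
    by (subst (asm) integrable_distr_eq) auto
  have "(\<integral>w. f w \<partial>L) = (\<integral>z. f (?T z) \<partial>(?B \<Otimes>\<^sub>M (\<nu> \<Otimes>\<^sub>M L)))"
    by (subst L_fixed_point, subst integral_distr) auto
  also have "\<dots> = (\<integral>b. \<integral>z. f (?T (b, z)) \<partial>(\<nu> \<Otimes>\<^sub>M L) \<partial>?B)"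
    by (rule Q.integral_fst'[symmetric, OF int])
  also have "\<dots> = p * f 0 + (1 - p) * (\<integral>z. f (a * fst z + snd z) \<partial>(\<nu> \<Otimes>\<^sub>M L))"
    using p_pos p_less_1 by (simp add: nuL.prob_space)
  finally show ?thesis .
qed

lemma AE_L_nonneg:
  assumes nonneg: "AE x in \<nu>. 0 \<le> x" and a: "0 \<le> a"
  shows "AE w in L. 0 \<le> w"
proof -
  let ?P = "\<Pi>\<^sub>M i\<in>(UNIV :: nat set). \<nu>"
  interpret Q: pair_sigma_finite "measure_pmf (geometric_pmf p)" ?P ..
  have "AE x in ?P. 0 \<le> x i" for i
    by (rule AE_PiM_component) (use nonneg in \<open>auto intro: nu.prob_space_axioms\<close>)
  hence "AE x in ?P. \<forall>i. 0 \<le> x i"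
    by (simp add: AE_all_countable)
  hence "AE x in ?P. 0 \<le> a * (\<Sum>i<n. x i)" for n
    by eventually_elim (use a in \<open>auto intro!: mult_nonneg_nonneg sum_nonneg\<close>)
  hence "AE \<omega> in measure_pmf (geometric_pmf p) \<Otimes>\<^sub>M ?P. 0 \<le> a * (\<Sum>i<fst \<omega>. snd \<omega> i)"
    by (intro Q.AE_pair_measure) auto
  thus ?thesis
    unfolding L_def geometric_sum_space_def by (subst AE_distr_iff) auto
qed

text \<open>By Tonelli, the absolute mean is at most \<open>\<bar>a\<bar>\<close> times the absolute
  mean of a summand times the mean of the count, and a geometric count has finite mean.\<close>

lemma integrable_L:
  assumes int: "integrable \<nu> (\<lambda>x. x)"
  shows "integrable L (\<lambda>w. w)"
proof (rule integrableI_bounded)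
  let ?P = "\<Pi>\<^sub>M i\<in>(UNIV :: nat set). \<nu>"
  define c where "c = (\<integral>\<^sup>+x. ennreal \<bar>x\<bar> \<partial>\<nu>)"
  have c: "c < \<infinity>"
    using int by (simp add: c_def integrable_iff_bounded)
  have comp: "(\<integral>\<^sup>+x. ennreal \<bar>x i\<bar> \<partial>?P) = c" for i :: nat
  proof -
    have "c = (\<integral>\<^sup>+x. ennreal \<bar>x\<bar> \<partial>distr ?P \<nu> (\<lambda>x. x i))"
      by (simp add: c_def seq.PiM_component)
    thus ?thesis by (subst (asm) nn_integral_distr) auto
  qed
  have "(\<integral>\<^sup>+w. ennreal (norm w) \<partial>L) =
    (\<integral>\<^sup>+n. \<integral>\<^sup>+x. ennreal \<bar>a * (\<Sum>i<n. x i)\<bar> \<partial>?P \<partial>measure_pmf (geometric_pmf p))"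
    by (subst nn_integral_L) auto
  also have "\<dots> \<le> (\<integral>\<^sup>+n. ennreal \<bar>a\<bar> * (c * of_nat n) \<partial>measure_pmf (geometric_pmf p))"
  proof (rule nn_integral_mono)
    fix n
    have "(\<integral>\<^sup>+x. ennreal \<bar>a * (\<Sum>i<n. x i)\<bar> \<partial>?P) \<le> (\<integral>\<^sup>+x. ennreal \<bar>a\<bar> * (\<Sum>i<n. ennreal \<bar>x i\<bar>) \<partial>?P)"
      by (intro nn_integral_mono)
         (auto simp: abs_mult ennreal_mult[symmetric] intro!: ennreal_leI mult_left_mono)
    also have "\<dots> = ennreal \<bar>a\<bar> * (c * of_nat n)"
      by (simp add: nn_integral_cmult nn_integral_sum comp mult.commute del: sum_ennreal)
    finally show "(\<integral>\<^sup>+x. ennreal \<bar>a * (\<Sum>i<n. x i)\<bar> \<partial>?P) \<le> ennreal \<bar>a\<bar> * (c * of_nat n)" .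
  qed
  also have "\<dots> = ennreal \<bar>a\<bar> * (c * (\<integral>\<^sup>+n. of_nat n \<partial>measure_pmf (geometric_pmf p)))"
    by (simp add: nn_integral_cmult)
  also have "\<dots> < \<infinity>"
  proof -
    have "integrable (geometric_pmf p) real"
      using p_pos p_less_1 by (intro integrable_real_geometric_pmf) auto
    hence "(\<integral>\<^sup>+n. of_nat n \<partial>measure_pmf (geometric_pmf p)) < \<infinity>"
      by (simp add: integrable_iff_bounded ennreal_of_nat_eq_real_of_nat)
    thus ?thesis using c by (simp add: ennreal_mult_less_top)
  qed
  finally show "(\<integral>\<^sup>+w. ennreal (norm w) \<partial>L) < \<infinity>" .
qed measurable

text \<open>\<open>scale\<close> says that \<open>L\<close> has mean 1, like the exponential law.
  First-order terms therefore match, and only the quadratic Taylor remainder is left.\<close>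

lemma stein_bound:
  assumes lip: "1-lipschitz_on UNIV h"
    and nonneg: "AE x in \<nu>. 0 \<le> x" and a: "0 \<le> a"
    and int: "integrable \<nu> (\<lambda>x. x)" and int2: "integrable \<nu> (\<lambda>x. x\<^sup>2)"
    and scale: "(1 - p) * (a * (\<integral>x. x \<partial>\<nu>)) = p"
  shows "\<bar>(\<integral>w. h w \<partial>L) - (\<integral>z. h z \<partial>exponential_law)\<bar> \<le> (1 - p) / p * (a\<^sup>2 * (\<integral>x. x\<^sup>2 \<partial>\<nu>))"
proof -
  interpret S: exponential_stein h by standard (rule lip)
  interpret nuL: pair_prob_space \<nu> L ..
  let ?Q = "\<nu> \<Otimes>\<^sub>M L"
  define g where "g w = h w - S.shift_mean w" for w
  \<comment> \<open>\<open>g\<close> is the derivative of the Stein solution, and \<open>D z\<close>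
    is the Taylor remainder of that solution at \<open>snd z\<close> for the increment
    \<open>a * fst z\<close>.\<close>
  define D where "D z = S.shift_mean (snd z) - S.shift_mean (a * fst z + snd z) - a * (fst z * g (snd z))" for z
  have [measurable]: "S.shift_mean \<in> borel_measurable borel"
    using borel_measurable_continuous_onI[OF lipschitz_on_continuous_on[OF S.lipschitz_shift_mean]] .
  have [measurable]: "g \<in> borel_measurable borel"
    unfolding g_def by measurable
  have c: "(\<integral>z. h z \<partial>exponential_law) = S.shift_mean 0"
    by (simp add: S.shift_mean_def)
  have int_h: "integrable L h" and int_shift_mean: "integrable L S.shift_mean"
    using integrable_L[OF int]
    by (auto intro!: integrable_lipschitz[OF lip] integrable_lipschitz[OF S.lipschitz_shift_mean]
        L.finite_measure_axioms)
  have int_g: "integrable L g"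
    unfolding g_def using int_h int_shift_mean by simp
  \<comment> \<open>The constant 1 as one factor turns the product rule into a statement about a
    single coordinate.\<close>
  have int_fst: "integrable ?Q fst" and int_snd: "integrable ?Q snd"
    using nuL.integrable_times_pair[OF int, of "\<lambda>_. 1"]
      nuL.integrable_times_pair[OF _ integrable_L[OF int], of "\<lambda>_. 1"] by simp_all
  have int_shift_mean_sum: "integrable ?Q (\<lambda>z. S.shift_mean (a * fst z + snd z))"
  proof (rule Bochner_Integration.integrable_bound)
    show "integrable ?Q (\<lambda>z. \<bar>S.shift_mean 0\<bar> + \<bar>a * fst z + snd z\<bar>)"
      using int_fst int_snd by auto
    have "\<bar>S.shift_mean x\<bar> \<le> \<bar>S.shift_mean 0\<bar> + \<bar>x\<bar>" for x
      using S.abs_diff_shift_mean[of x 0] by linarith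
    thus "AE z in ?Q. norm (S.shift_mean (a * fst z + snd z)) \<le> norm (\<bar>S.shift_mean 0\<bar> + \<bar>a * fst z + snd z\<bar>)"
      by simp
  qed measurable
  have int_shift_mean_snd: "integrable ?Q (\<lambda>z. S.shift_mean (snd z))"
    and shift_mean_snd: "(\<integral>z. S.shift_mean (snd z) \<partial>?Q) = (\<integral>w. S.shift_mean w \<partial>L)"
    using nuL.integrable_times_pair[OF _ int_shift_mean, of "\<lambda>_. 1"]
      nuL.integral_times_pair[OF _ int_shift_mean, of "\<lambda>_. 1"] nu.prob_space by simp_all
  have int_fst_g: "integrable ?Q (\<lambda>z. fst z * g (snd z))"
    and fst_g: "(\<integral>z. fst z * g (snd z) \<partial>?Q) = (\<integral>x. x \<partial>\<nu>) * (\<integral>w. g w \<partial>L)"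
    using nuL.integrable_times_pair[OF int int_g] nuL.integral_times_pair[OF int int_g] by simp_all
  have int_D: "integrable ?Q D"
    unfolding D_def using int_shift_mean_sum int_shift_mean_snd int_fst_g by simp
  \<comment> \<open>The Stein solution vanishes at 0, so the case of an empty sum contributes
    nothing to the fixed point.\<close>
  have renewal: "S.shift_mean 0 - (\<integral>w. S.shift_mean w \<partial>L) = (1 - p) * (S.shift_mean 0 - (\<integral>z. S.shift_mean (a * fst z + snd z) \<partial>?Q))"
    using integral_L[of "\<lambda>w. S.shift_mean 0 - S.shift_mean w"] int_shift_mean int_shift_mean_sum L.prob_space nuL.prob_space by simp
  have "(1 - p) * (\<integral>z. D z \<partial>?Q) = (1 - p) * ((\<integral>w. S.shift_mean w \<partial>L) -
      (\<integral>z. S.shift_mean (a * fst z + snd z) \<partial>?Q)) - (1 - p) * (a * (\<integral>x. x \<partial>\<nu>)) * (\<integral>w. g w \<partial>L)"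
    unfolding D_def using int_shift_mean_sum int_shift_mean_snd int_fst_g
    by (simp add: shift_mean_snd fst_g algebra_simps)
  \<comment> \<open>\<open>renewal\<close> turns the first difference into \<open>p\<close> times
    \<open>S.shift_mean 0\<close> minus its mean under \<open>L\<close>; \<open>scale\<close> gives
    the mean of \<open>g\<close> the coefficient \<open>p\<close>, and the means of
    \<open>S.shift_mean\<close> cancel.\<close>
  also have "\<dots> = - p * ((\<integral>w. h w \<partial>L) - S.shift_mean 0)"
    unfolding scale using renewal int_h int_shift_mean by (simp add: g_def algebra_simps)
  finally have eq: "(1 - p) * (\<integral>z. D z \<partial>?Q) = - p * ((\<integral>w. h w \<partial>L) - S.shift_mean 0)" .
  have "\<bar>\<integral>z. D z \<partial>?Q\<bar> \<le> (\<integral>z. \<bar>D z\<bar> \<partial>?Q)"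
    by (rule integral_abs_bound)
  also have "\<dots> \<le> (\<integral>z. a\<^sup>2 * ((fst z)\<^sup>2 * 1) \<partial>?Q)"
  proof (rule integral_mono_AE)
    have "AE z in ?Q. 0 \<le> fst z"
    proof (rule nuL.AE_pair_measure)
      show "{z \<in> space ?Q. 0 \<le> fst z} \<in> sets ?Q" by measurable
    qed (use nonneg in simp)
    thus "AE z in ?Q. \<bar>D z\<bar> \<le> a\<^sup>2 * ((fst z)\<^sup>2 * 1)"
    proof eventually_elim
      case (elim z)
      show ?case
        using S.taylor_shift_mean[of "a * fst z" "snd z"] elim a
        by (simp add: D_def g_def add.commute power_mult_distrib mult.assoc)
    qed
  qed (use int_D nuL.integrable_times_pair[OF int2, of "\<lambda>_. 1"] in simp_all)
  also have "\<dots> = a\<^sup>2 * (\<integral>x. x\<^sup>2 \<partial>\<nu>)"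
    using nuL.integral_times_pair[OF int2, of "\<lambda>_. 1"] L.prob_space by simp
  finally have "(1 - p) * \<bar>\<integral>z. D z \<partial>?Q\<bar> \<le> (1 - p) * (a\<^sup>2 * (\<integral>x. x\<^sup>2 \<partial>\<nu>))"
    using p_less_1 by (intro mult_left_mono) auto
  also have "(1 - p) * \<bar>\<integral>z. D z \<partial>?Q\<bar> = \<bar>(1 - p) * (\<integral>z. D z \<partial>?Q)\<bar>"
    using p_less_1 by (simp add: abs_mult)
  also have "\<dots> = p * \<bar>(\<integral>w. h w \<partial>L) - S.shift_mean 0\<bar>"
    unfolding eq using p_pos by (simp add: abs_mult)
  finally show ?thesis
    using p_pos by (simp add: c field_simps)
qed

lemma laplace_lower_bound:
  assumes nonneg: "AE x in \<nu>. 0 \<le> x" and a: "0 \<le> a"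
    and int: "integrable \<nu> (\<lambda>x. x)"
    and scale: "(1 - p) * (a * (\<integral>x. x \<partial>\<nu>)) = p" and p: "p \<le> 1 / 2"
  shows "1 / 2 + p / 16 \<le> (\<integral>w. exp (- w) \<partial>L)"
proof -
  interpret nuL: pair_prob_space \<nu> L ..
  define m where "m = (\<integral>x. x \<partial>\<nu>)"
  define \<phi> where "\<phi> = (\<integral>x. exp (- (a * x)) \<partial>\<nu>)"
  define l where "l = (\<integral>w. exp (- w) \<partial>L)"
  have int_nu: "integrable \<nu> (\<lambda>x. exp (- (a * x)))"
    by (rule nu.integrable_const_bound[where B = 1]) (use nonneg a in \<open>auto elim!: eventually_mono\<close>)
  have int_L: "integrable L (\<lambda>w. exp (- w))"
    by (rule L.integrable_const_bound[where B = 1])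
       (use AE_L_nonneg[OF nonneg a] in \<open>auto elim!: eventually_mono\<close>)
  have "(\<integral>z. exp (- (a * fst z + snd z)) \<partial>(\<nu> \<Otimes>\<^sub>M L)) = \<phi> * l"
    using nuL.integral_times_pair[OF int_nu int_L] by (simp add: \<phi>_def l_def mult_exp_exp)
  hence rec: "l = p + (1 - p) * (\<phi> * l)"
    using integral_L[OF int_L] by (simp add: l_def)
  define t where "t = a * m"
  have qt: "(1 - p) * t = p" using scale by (simp add: t_def m_def)
  have t: "t = p / (1 - p)" using qt p_less_1 by (simp add: field_simps)
  have "p \<le> t" using p_pos p_less_1 by (simp add: t field_simps)
  have "t \<le> 1" using p p_less_1 by (simp add: t field_simps)
  \<comment> \<open>Jensen's inequality by a tangent line: \<open>t\<close> is the mean of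
    \<open>a * x\<close>, so the linear term integrates to 0.\<close>
  have "exp (- t) = (\<integral>x. exp (- t) * (1 + (t - a * x)) \<partial>\<nu>)"
    using int nu.prob_space by (simp add: m_def t_def)
  also have "\<dots> \<le> \<phi>"
    unfolding \<phi>_def
  proof (rule integral_mono[OF _ int_nu])
    fix x
    have "exp (- t) * (1 + (t - a * x)) \<le> exp (- t) * exp (t - a * x)"
      by (intro mult_left_mono exp_ge_add_one_self) auto
    thus "exp (- t) * (1 + (t - a * x)) \<le> exp (- (a * x))"
      by (simp add: mult_exp_exp)
  qed (use int in simp)
  finally have "exp (- t) \<le> \<phi>" .
  \<comment> \<open>The linear bound \<open>1 - t\<close> would give \<open>1 - 2 * p\<close> below
    and hence only \<open>1 / 2 \<le> l\<close>; the extra \<open>t\<^sup>2 / 4\<close> produces the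
    gain of order \<open>p\<close>.\<close>
  have "(1 - t / 2)\<^sup>2 \<le> (exp (- t / 2))\<^sup>2"
    using exp_ge_add_one_self[of "- t / 2"] \<open>t \<le> 1\<close> by (intro power_mono) auto
  also have "\<dots> = exp (- t)"
    by (simp add: power2_eq_square mult_exp_exp)
  finally have "(1 - t / 2)\<^sup>2 \<le> \<phi>"
    using \<open>exp (- t) \<le> \<phi>\<close> by simp
  hence "(1 - p) * (1 - t / 2)\<^sup>2 \<le> (1 - p) * \<phi>"
    using p_less_1 by (intro mult_left_mono) auto
  also have "(1 - p) * (1 - t / 2)\<^sup>2 = 1 - p - (1 - p) * t + (1 - p) * t * t / 4"
    by (simp add: power2_eq_square field_simps)
  also have "\<dots> = 1 - 2 * p + p * t / 4"
    unfolding qt by simp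
  finally have "1 - 2 * p + p * p / 4 \<le> (1 - p) * \<phi>"
    using mult_left_mono[OF \<open>p \<le> t\<close>, of p] p_pos by linarith
  moreover have "0 \<le> l" by (simp add: l_def)
  ultimately have "(1 - 2 * p + p * p / 4) * l \<le> (1 - p) * \<phi> * l"
    by (rule mult_right_mono)
  also have "\<dots> = l - p" using rec by simp
  finally have "p * 1 \<le> p * ((2 - p / 4) * l)"
    by (simp add: algebra_simps)
  hence "1 \<le> (2 - p / 4) * l"
    using p_pos by (simp only: mult_le_cancel_left_pos)
  \<comment> \<open>With 1/16 the terms linear in \<open>p\<close> cancel, and the product is
    \<open>1 - p\<^sup>2 / 64\<close>.\<close>
  moreover have "(2 - p / 4) * (1 / 2 + p / 16) \<le> 1"
    by (simp add: algebra_simps)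
  ultimately have "(2 - p / 4) * (1 / 2 + p / 16) \<le> (2 - p / 4) * l"
    by linarith
  thus ?thesis
    using p_less_1 by (simp add: l_def)
qed

end

subsection \<open>Bounds on the Wasserstein distance\<close>

text \<open>A test function may be non-measurable on the negative axis; \<open>H\<close> is a
  measurable replacement agreeing with it where the law lives.\<close>

lemma set_integral_nonneg_eq_integral:
  fixes h H :: "real \<Rightarrow> real"
  assumes P: "sets P = sets borel" and nonneg: "AE x in P. 0 \<le> x"
    and [measurable]: "H \<in> borel_measurable borel" and eq: "\<And>x. 0 \<le> x \<Longrightarrow> h x = H x"
  shows "(LINT x:{0..}|P. h x) = (\<integral>x. H x \<partial>P)"
proof -
  note [measurable_cong] = P
  have "(LINT x:{0..}|P. h x) = (\<integral>x. indicator {0..} x * H x \<partial>P)"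
    unfolding set_lebesgue_integral_def
    by (intro Bochner_Integration.integral_cong) (auto simp: indicator_def eq)
  also have "\<dots> = (\<integral>x. H x \<partial>P)"
    by (rule integral_cong_AE) (use nonneg in \<open>auto elim!: eventually_mono\<close>)
  finally show ?thesis .
qed

text \<open>Composing with the 1-Lipschitz projection \<open>max 0\<close> extends a test function
  to the whole line, where the Stein argument is carried out, without changing it on the
  half-line.\<close>

lemma wasserstein_dist_leI:
  assumes "sets P = sets borel" "AE x in P. 0 \<le> x" "sets Q = sets borel" "AE x in Q. 0 \<le> x"
    and le: "\<And>h. 1-lipschitz_on UNIV h \<Longrightarrow> \<bar>(\<integral>x. h x \<partial>P) - (\<integral>x. h x \<partial>Q)\<bar> \<le> B"
  shows "wasserstein_dist P Q \<le> ennreal B"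
  unfolding wasserstein_dist_def
proof (rule SUP_least)
  fix h :: "real \<Rightarrow> real" assume "h \<in> {h. 1-lipschitz_on {0..} h}"
  hence h: "1-lipschitz_on {0..} h" by simp
  define H where "H x = h (max 0 x)" for x
  have H: "1-lipschitz_on UNIV H"
  proof (rule lipschitz_onI)
    fix x y :: real
    have "dist (H x) (H y) \<le> 1 * dist (max 0 x) (max 0 y)"
      unfolding H_def by (rule lipschitz_onD[OF h]) auto
    also have "\<dots> \<le> 1 * dist x y" by (auto simp: dist_real_def max_def)
    finally show "dist (H x) (H y) \<le> 1 * dist x y" .
  qed simp
  have [measurable]: "H \<in> borel_measurable borel"
    by (rule borel_measurable_continuous_onI[OF lipschitz_on_continuous_on[OF H]])
  have H_eq: "h x = H x" if "0 \<le> x" for x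
    using that by (simp add: H_def)
  have "(LINT x:{0..}|P. h x) = (\<integral>x. H x \<partial>P)" "(LINT x:{0..}|Q. h x) = (\<integral>x. H x \<partial>Q)"
    using assms(1-4) H_eq by (auto intro!: set_integral_nonneg_eq_integral[where H = H])
  thus "ennreal \<bar>(LINT x:{0..}|P. h x) - (LINT x:{0..}|Q. h x)\<bar> \<le> ennreal B"
    using le[OF H] by (simp add: ennreal_leI)
qed

text \<open>For \<open>0 \<le> x \<le> y\<close> the difference factors as
  \<open>exp (- x) * (1 - exp (x - y))\<close>, with first factor at most 1 and second at most
  \<open>y - x\<close>.\<close>

lemma lipschitz_exp_uminus: "1-lipschitz_on {0..} (\<lambda>x :: real. exp (- x))"
proof (rule lipschitz_onI)
  have *: "\<bar>exp (- x) - exp (- y)\<bar> \<le> \<bar>x - y\<bar>" if "0 \<le> x" "x \<le> y" for x y :: real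
  proof -
    have "exp (- x) * (1 - exp (x - y)) \<le> 1 * (y - x)"
      using that exp_ge_add_one_self[of "x - y"] by (intro mult_mono) (simp, linarith, auto)
    moreover have "exp (- y) \<le> exp (- x)" using that by simp
    ultimately show ?thesis
      using that by (simp add: right_diff_distrib mult_exp_exp)
  qed
  show "dist (exp (- x)) (exp (- y)) \<le> 1 * dist x y" if "x \<in> {0..}" "y \<in> {0..}" for x y :: real
    using that *[of x y] *[of y x] by (cases "x \<le> y") (auto simp: dist_real_def abs_minus_commute)
qed simp

lemma wasserstein_dist_ge_laplace:
  assumes "sets P = sets borel" "AE x in P. 0 \<le> x" "sets Q = sets borel" "AE x in Q. 0 \<le> x"
  shows "ennreal \<bar>(\<integral>x. exp (- x) \<partial>P) - (\<integral>x. exp (- x) \<partial>Q)\<bar> \<le> wasserstein_dist P Q"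
proof -
  have "(LINT x:{0..}|P. exp (- x)) = (\<integral>x. exp (- x) \<partial>P)"
    "(LINT x:{0..}|Q. exp (- x)) = (\<integral>x. exp (- x) \<partial>Q)"
    using assms by (auto intro!: set_integral_nonneg_eq_integral)
  thus ?thesis
    unfolding wasserstein_dist_def
    using lipschitz_exp_uminus by (intro SUP_upper2[where i = "\<lambda>x. exp (- x)"]) auto
qed

theorem theorem3p1:
  fixes \<nu> :: "real measure" and \<mu> \<mu>2 :: real
  assumes "prob_space \<nu>" and "sets \<nu> = sets borel"
    and "AE x in \<nu>. 0 \<le> x"
    and "integrable \<nu> (\<lambda>x. x)" and "(\<integral>x. x \<partial>\<nu>) = \<mu>" and "0 < \<mu>"
    and "integrable \<nu> (\<lambda>x. x\<^sup>2)" and "(\<integral>x. x\<^sup>2 \<partial>\<nu>) = \<mu>2"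
  shows "(\<forall>p (M :: 'a measure) X N (M' :: 'b measure) Z.
            p \<in> {0<..<1} \<longrightarrow> geometric_sum M \<nu> p X N \<longrightarrow>
            prob_space M' \<longrightarrow> distributed M' lborel Z (exponential_density 1) \<longrightarrow>
            wasserstein_dist
              (distr M borel (\<lambda>\<omega>. p / (\<mu> * (1 - p)) * (\<Sum>i<N \<omega>. X i \<omega>)))
              (distr M' borel Z)
            \<le> ennreal (p * \<mu>2 / ((1 - p) * \<mu>\<^sup>2)))
       \<and> (\<exists>c>0. \<exists>p0\<in>{0<..<1}. \<forall>p\<in>{0<..<p0}.
            ennreal (c * p) \<le>
            wasserstein_dist
              (distr (geometric_sum_space \<nu> p) borel
                (\<lambda>\<omega>. p / (\<mu> * (1 - p)) * (\<Sum>i<fst \<omega>. snd \<omega> i)))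
              (density lborel (exponential_density 1)))"
proof -
  interpret nu: prob_space \<nu> by fact
  have law: "geometric_sum_law \<nu> p" if "p \<in> {0<..<1}" for p
    using that assms(2) by unfold_locales auto
  have scale: "(1 - p) * (p / (\<mu> * (1 - p)) * (\<integral>x. x \<partial>\<nu>)) = p" if "p \<in> {0<..<1}" for p
    using that assms(5,6) by simp
  have a: "0 \<le> p / (\<mu> * (1 - p))" if "p \<in> {0<..<1}" for p
    using that assms(6) by simp
  show ?thesis
  proof (intro conjI allI impI)
    fix p :: real and M :: "'a measure" and X N and M' :: "'b measure" and Z
    assume p: "p \<in> {0<..<1}" and sum: "geometric_sum M \<nu> p X N"
      and "prob_space M'" and Z: "distributed M' lborel Z (exponential_density 1)"
    let ?a = "p / (\<mu> * (1 - p))"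
    interpret G: geometric_sum_law \<nu> p ?a by (rule law[OF p])
    \<comment> \<open>Every realisation of the sum has the law of the coordinate one, so the
      estimates for \<open>G.L\<close> cover all of them.\<close>
    have W: "distr M borel (\<lambda>\<omega>. ?a * (\<Sum>i<N \<omega>. X i \<omega>)) = G.L"
      unfolding G.L_def by (rule geometric_sum.law_scaled_sum[OF sum])
    have "distr M' borel Z = distr M' lborel Z"
      by (rule distr_cong) auto
    hence Z': "distr M' borel Z = exponential_law"
      using Z by (simp add: distributed_def)
    have "wasserstein_dist G.L exponential_law \<le> ennreal ((1 - p) / p * (?a\<^sup>2 * (\<integral>x. x\<^sup>2 \<partial>\<nu>)))"
      using G.AE_L_nonneg[OF assms(3) a[OF p]] AE_exponential_law_nonneg
        G.stein_bound[OF _ assms(3) a[OF p] assms(4,7) scale[OF p]]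
      by (intro wasserstein_dist_leI) auto
    also have "(1 - p) / p * (?a\<^sup>2 * (\<integral>x. x\<^sup>2 \<partial>\<nu>)) = p * \<mu>2 / ((1 - p) * \<mu>\<^sup>2)"
      using p assms(6) unfolding assms(8) by (simp add: divide_simps power2_eq_square)
    finally show "wasserstein_dist
              (distr M borel (\<lambda>\<omega>. p / (\<mu> * (1 - p)) * (\<Sum>i<N \<omega>. X i \<omega>)))
              (distr M' borel Z)
            \<le> ennreal (p * \<mu>2 / ((1 - p) * \<mu>\<^sup>2))"
      unfolding W Z' .
  next
    \<comment> \<open>The witnesses \<open>c = 1 / 16\<close> and \<open>p0 = 1 / 2\<close> come
      from the Laplace transform bound and are the same for every summand law.\<close>
    have "ennreal (1 / 16 * p) \<le>
        wasserstein_dist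
          (distr (geometric_sum_space \<nu> p) borel
            (\<lambda>\<omega>. p / (\<mu> * (1 - p)) * (\<Sum>i<fst \<omega>. snd \<omega> i)))
          exponential_law" if "p \<in> {0<..<1 / 2}" for p
    proof -
      have p: "p \<in> {0<..<1}" "p \<le> 1 / 2" using that by auto
      let ?a = "p / (\<mu> * (1 - p))"
      interpret G: geometric_sum_law \<nu> p ?a by (rule law[OF p(1)])
      have "ennreal (1 / 16 * p) \<le>
        ennreal \<bar>(\<integral>x. exp (- x) \<partial>G.L) - (\<integral>x. exp (- x) \<partial>exponential_law)\<bar>"
        using G.laplace_lower_bound[OF assms(3) a[OF p(1)] assms(4) scale[OF p(1)] p(2)]
        unfolding laplace_exponential_law by (intro ennreal_leI) linarith
      also have "\<dots> \<le> wasserstein_dist G.L exponential_law"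
        using G.AE_L_nonneg[OF assms(3) a[OF p(1)]] AE_exponential_law_nonneg
        by (intro wasserstein_dist_ge_laplace) auto
      finally show ?thesis unfolding G.L_def .
    qed
    thus "\<exists>c>0. \<exists>p0\<in>{0<..<1}. \<forall>p\<in>{0<..<p0}.
            ennreal (c * p) \<le>
            wasserstein_dist
              (distr (geometric_sum_space \<nu> p) borel
                (\<lambda>\<omega>. p / (\<mu> * (1 - p)) * (\<Sum>i<fst \<omega>. snd \<omega> i)))
              (density lborel (exponential_density 1))"
      by (intro exI[of _ "1 / 16"] conjI bexI[of _ "1 / 2"]) auto
  qed
qed

end
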